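(* Let $k\ge 3$. Let $G'$ be a $k$-colorable connected graph of order $n$, diameter $D$ and minimum degree at least $\delta$. Then there is a connected graph $G$ of order $n$, diameter $D$ and minimum degree at least $\delta$, together with a proper $k$-coloring of $G$ and a vertex $x$ of eccentricity $D$, such that, writing $L_j$ for the set of vertices at distance $j$ from $x$ ($0\le j\le D$) and $c(j)$ for the number of colors used on $L_j$, the following hold for every $i$ with $0\le i\le D-1$: (i) if $c(i)=1$, then $c(i+1)\le k-1$; (ii) the number of colors used on $L_i\cup L_{i+1}$ is $\min(k,c(i)+c(i+1))$; in particular, if $c(i)+c(i+1)\le k$ then $L_i$ and $L_{i+1}$ share no color; (iii) if $c(i)=k$, then $i\ge 2$ and $c(i+1)\ge 2$; (iv) if $|L_i|>c(i)$ (i.e. $L_i$ contains two vertices of the same color), then $i>0$ and $c(i)+\max\bigl(c(i-1),c(i+1)\bigr)\ge k$.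
   Context: The eccentricity of a vertex is the maximum of its distances to the other vertices; $L_0,\dots,L_D$ are called layers. *)

theory Defs
  imports "Graph_Theory.Graph_Theory"
begin

text \<open>
  A finite simple graph is a \<^locale>\<open>pair_graph\<close>: finitely many vertices, and the set of ordered
  pairs of adjacent vertices as arcs, which is symmetric and irreflexive. As each undirected edge
  gives two opposite arcs, the degree of a vertex is its \<^const>\<open>out_degree\<close>.
\<close>

definition min_degree :: "('a, 'b) pre_digraph \<Rightarrow> nat" where
  "min_degree G = Min (out_degree G ` verts G)"

text \<open>Unspecified (as \<open>LEAST\<close> over the empty set) if \<open>v\<close> is not reachable from \<open>u\<close>.\<close>

definition graph_dist :: "('a, 'b) pre_digraph \<Rightarrow> 'a \<Rightarrow> 'a \<Rightarrow> nat" where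
  "graph_dist G u v = (LEAST l. \<exists>p. pre_digraph.awalk G u p v \<and> length p = l)"

lemma (in wf_digraph) graph_dist_eq_mu:
  assumes "u \<rightarrow>\<^sup>* v"
  shows "ereal (real (graph_dist G u v)) = \<mu> (\<lambda>_. 1) u v"
proof -
  have cost: "awalk_cost (\<lambda>_. 1) p = real (length p)" for p
    by (induct p) auto
  have ex: "\<exists>l p. awalk u p v \<and> length p = l"
    using assms reachable_awalk by auto
  obtain p where p: "awalk u p v" "length p = graph_dist G u v"
    using LeastI_ex[OF ex] unfolding graph_dist_def by blast
  have le: "graph_dist G u v \<le> length q" if "awalk u q v" for q
    unfolding graph_dist_def by (rule Least_le) (use that in blast)
  have "\<mu> (\<lambda>_. 1) u v \<le> ereal (real (graph_dist G u v))"
    using min_cost_le_walk_cost[OF p(1), of "\<lambda>_. 1"] p(2) by (simp add: cost)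
  moreover have "ereal (real (graph_dist G u v)) \<le> \<mu> (\<lambda>_. 1) u v"
    unfolding \<mu>_def by (rule INF_greatest) (use le in \<open>auto simp: cost\<close>)
  ultimately show ?thesis by (rule antisym[rotated])
qed

text \<open>
  The maximum includes the distance \<open>0\<close> from \<open>x\<close> to itself; this only matters for the one-vertex
  graph, whose eccentricity and diameter are thereby \<open>0\<close>.
\<close>

definition eccentricity :: "('a, 'b) pre_digraph \<Rightarrow> 'a \<Rightarrow> nat" where
  "eccentricity G x = Max (graph_dist G x ` verts G)"

definition diameter :: "('a, 'b) pre_digraph \<Rightarrow> nat" where
  "diameter G = Max {graph_dist G u v | u v. u \<in> verts G \<and> v \<in> verts G}"

definition layer :: "('a, 'b) pre_digraph \<Rightarrow> 'a \<Rightarrow> nat \<Rightarrow> 'a set" where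
  "layer G x j = {v \<in> verts G. graph_dist G x v = j}"

text \<open>The colors are \<open>0, \<dots>, k - 1\<close>; not all of them need to be used.\<close>

definition proper_coloring :: "('a, 'b) pre_digraph \<Rightarrow> nat \<Rightarrow> ('a \<Rightarrow> nat) \<Rightarrow> bool" where
  "proper_coloring G k col \<longleftrightarrow>
     col ` verts G \<subseteq> {..<k} \<and> (\<forall>u v. u \<rightarrow>\<^bsub>G\<^esub> v \<longrightarrow> col u \<noteq> col v)"

definition colorable :: "('a, 'b) pre_digraph \<Rightarrow> nat \<Rightarrow> bool" where
  "colorable G k \<longleftrightarrow> (\<exists>col. proper_coloring G k col)"

definition num_colors :: "('a \<Rightarrow> nat) \<Rightarrow> 'a set \<Rightarrow> nat" where
  "num_colors col S = card (col ` S)"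

end

theory Submission
  imports Defs "HOL-Combinatorics.Transposition"
begin

text \<open>
  Fix a vertex \<open>x\<close> whose eccentricity is the diameter \<open>D\<close>, the distance layers of \<open>x\<close>, and a proper
  coloring. Joining any two differently colored vertices in the same or in consecutive layers keeps
  the distances from \<open>x\<close>, and if \<open>D \<ge> 2\<close> also the diameter. So the graph is encoded by a
  layering \<open>l\<close> and a coloring \<open>c\<close> in which every vertex has a differently colored vertex in the
  layer below. Among all such pairs with minimum degree at least \<open>\<delta>\<close>, take one with the
  maximum number of edges. Then (i) is clear, and a violation of (ii), (iii) or (iv) yields a pair
  with more edges.

  (ii): If layers \<open>i\<close> and \<open>i + 1\<close> share a color while another color is missing in both, exchange these
  two colors above layer \<open>i\<close>.

  (iv): One of two equally colored vertices in layer \<open>i\<close> can be given a color missing in layers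
  \<open>i - 1\<close> and \<open>i\<close>, after a transposition of colors above layer \<open>i\<close> has removed this color from
  layer \<open>i + 1\<close>.

  (iii): Let layer \<open>i\<close> use all colors and layer \<open>i + 1\<close> only the color \<open>a\<close>. If layer \<open>i - 2\<close> contains
  a color other than \<open>a\<close>, move the vertices of color \<open>a\<close> from layer \<open>i\<close> to layer \<open>i - 1\<close>. Otherwise the
  vertices of layers \<open>i - 1\<close> and \<open>i\<close> with color different from \<open>a\<close> are redistributed, without changing
  how many of them lie in each layer, such that one of the two layers avoids some color \<open>b \<noteq> a\<close>. The
  vertices of color \<open>a\<close> go to that layer, and its monochromatic neighbor outside the two layers is
  recolored from \<open>a\<close> to \<open>b\<close>.
\<close>

section \<open>Colored layerings and the edge-maximal choice\<close>

definition nbrs :: "'a set \<Rightarrow> ('a \<Rightarrow> nat) \<Rightarrow> ('a \<Rightarrow> nat) \<Rightarrow> 'a \<Rightarrow> 'a set" where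
  "nbrs V l c v = {u \<in> V. c u \<noteq> c v \<and> l u \<le> Suc (l v) \<and> l v \<le> Suc (l u)}"

text \<open>The edge set is implicit: all pairs that \<open>nbrs\<close> allows. \<open>root\<close>
  and \<open>parent\<close> make \<open>l v\<close> the distance from \<open>x\<close> in that
  graph, as every vertex can descend to layer 0.\<close>

locale colored_layering =
  fixes V :: "'a set" and x :: 'a and k D :: nat and l c :: "'a \<Rightarrow> nat"
  assumes fin: "finite V"
    and x_in: "x \<in> V"
    and root: "v \<in> V \<Longrightarrow> l v = 0 \<longleftrightarrow> v = x"
    and le_D: "v \<in> V \<Longrightarrow> l v \<le> D"
    and top: "\<exists>v\<in>V. l v = D"
    and col_lt: "v \<in> V \<Longrightarrow> c v < k"
    and parent: "v \<in> V \<Longrightarrow> l v > 0 \<Longrightarrow> \<exists>u\<in>V. l v = Suc (l u) \<and> c u \<noteq> c v"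
begin

lemma layer_nonempty: "i \<le> D \<Longrightarrow> \<exists>v\<in>V. l v = i"
proof (induction rule: inc_induct)
  case base then show ?case by (rule top)
next
  case (step i)
  then obtain v where "v \<in> V" "l v = Suc i" by blast
  with parent[of v] show ?case by auto
qed

lemma finite_nbrs: "finite (nbrs V l' c' v)"
  using fin by (auto simp: nbrs_def)

end

text \<open>The sum in \<open>maximal\<close> is twice the number of edges.\<close>

locale max_layering = colored_layering +
  fixes \<delta> :: nat
  assumes deg: "v \<in> V \<Longrightarrow> \<delta> \<le> card (nbrs V l c v)"
    and maximal: "\<And>l' c'. colored_layering V x k D l' c' \<Longrightarrow>
      (\<And>v. v \<in> V \<Longrightarrow> \<delta> \<le> card (nbrs V l' c' v)) \<Longrightarrow>
      (\<Sum>v\<in>V. card (nbrs V l' c' v)) \<le> (\<Sum>v\<in>V. card (nbrs V l c v))"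
begin

text \<open>If no neighborhood loses a vertex, the degree bound persists, so one strict gain would
  contradict \<open>maximal\<close>.\<close>

lemma nbrs_mono_eq:
  assumes l': "colored_layering V x k D l' c'"
    and sub: "\<And>v. v \<in> V \<Longrightarrow> nbrs V l c v \<subseteq> nbrs V l' c' v"
    and v: "v \<in> V"
  shows "nbrs V l' c' v = nbrs V l c v"
proof (rule ccontr)
  have le: "card (nbrs V l c w) \<le> card (nbrs V l' c' w)" if "w \<in> V" for w
    using that by (intro card_mono finite_nbrs sub)
  assume "nbrs V l' c' v \<noteq> nbrs V l c v"
  then have "card (nbrs V l c v) < card (nbrs V l' c' v)"
    using sub[OF v] by (intro psubset_card_mono finite_nbrs) auto
  then have "(\<Sum>v\<in>V. card (nbrs V l c v)) < (\<Sum>v\<in>V. card (nbrs V l' c' v))"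
    using le v by (intro sum_strict_mono_ex1 fin) auto
  moreover have "\<delta> \<le> card (nbrs V l' c' w)" if "w \<in> V" for w
    using deg[OF that] le[OF that] by simp
  ultimately show False using maximal[OF l'] by fastforce
qed

text \<open>With \<open>l\<close> unchanged, parents survive because a parent is itself a
  neighbor.\<close>

lemma recolor_nbrs_eq:
  assumes col: "\<And>v. v \<in> V \<Longrightarrow> c' v < k"
    and sub: "\<And>v. v \<in> V \<Longrightarrow> nbrs V l c v \<subseteq> nbrs V l c' v"
    and v: "v \<in> V"
  shows "nbrs V l c' v = nbrs V l c v"
proof (rule nbrs_mono_eq[OF _ sub v])
  have "\<exists>u\<in>V. l v = Suc (l u) \<and> c' u \<noteq> c' v" if "v \<in> V" "l v > 0" for v
  proof -
    obtain u where "u \<in> V" "l v = Suc (l u)" "c u \<noteq> c v"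
      using parent \<open>v \<in> V\<close> \<open>l v > 0\<close> by blast
    then show ?thesis using sub[OF \<open>v \<in> V\<close>] by (auto simp: nbrs_def)
  qed
  then show "colored_layering V x k D l c'"
    using fin x_in root le_D top col by unfold_locales auto
qed

section \<open>Recolorings behind (ii) and (iv)\<close>

lemma consecutive_colors:
  assumes u: "u \<in> V" "l u = i" and v: "v \<in> V" "l v = Suc i" and same: "c u = c v"
  shows "c ` {w \<in> V. l w = i} \<union> c ` {w \<in> V. l w = Suc i} = {..<k}"
proof (rule ccontr)
  assume "\<not> ?thesis"
  then obtain b where b: "b < k" "b \<notin> c ` {w \<in> V. l w = i}" "b \<notin> c ` {w \<in> V. l w = Suc i}"
    using col_lt by auto
  \<comment> \<open>A transposition is injective, so only adjacencies between layers
    \<open>i\<close> and \<open>i + 1\<close> are in danger. There color \<open>c u\<close> turns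
    into \<open>b\<close>, which is absent from layer \<open>i\<close>. The new adjacency is that of
    \<open>u\<close> and \<open>v\<close>.\<close>
  define c' where "c' w = (if l w \<le> i then c w else transpose (c u) b (c w))" for w
  have "nbrs V l c' u = nbrs V l c u"
  proof (rule recolor_nbrs_eq)
    show "c' w < k" if "w \<in> V" for w
      using that col_lt b(1) u(1) by (auto simp: c'_def transpose_def)
    show "nbrs V l c w \<subseteq> nbrs V l c' w" if "w \<in> V" for w
    proof
      fix y assume "y \<in> nbrs V l c w"
      then have y: "y \<in> V" "c y \<noteq> c w" "l y \<le> Suc (l w)" "l w \<le> Suc (l y)"
        by (auto simp: nbrs_def)
      consider "l w \<le> i \<longleftrightarrow> l y \<le> i" | "l w = i" "l y = Suc i" | "l y = i" "l w = Suc i"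
        using y by linarith
      then have "c' y \<noteq> c' w"
      proof cases
        case 1 then show ?thesis using y(2) by (auto simp: c'_def dest: transpose_eq_imp_eq)
      qed (use y that b in \<open>auto simp: c'_def transpose_def\<close>)
      with y show "y \<in> nbrs V l c' w" by (simp add: nbrs_def)
    qed
  qed (fact u)
  moreover have "v \<in> nbrs V l c' u"
    using u v b same by (auto simp: nbrs_def c'_def)
  ultimately show False using same by (auto simp: nbrs_def)
qed

lemma repeated_color:
  assumes uv: "u \<in> V" "v \<in> V" "u \<noteq> v" "l u = Suc i" "l v = Suc i" "c u = c v"
    and dis: "c ` {w \<in> V. l w = Suc i} \<inter> c ` {w \<in> V. l w = Suc (Suc i)} = {}"
    and b: "b < k" "b \<notin> c ` {w \<in> V. l w = i}" "b \<notin> c ` {w \<in> V. l w = Suc i}"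
    and e: "e < k" "e \<notin> c ` {w \<in> V. l w = Suc i}" "e \<notin> c ` {w \<in> V. l w = Suc (Suc i)}"
  shows False
proof -
  \<comment> \<open>As \<open>e\<close> is absent from layer \<open>i + 2\<close>, the transposition
    frees that layer of \<open>b\<close>; it brings in at most \<open>e\<close>, which is absent
    from layer \<open>i + 1\<close>. So \<open>b\<close> is a safe new color for \<open>v\<close>,
    and \<open>u\<close> becomes its neighbor.\<close>
  define c' where
    "c' w = (if w = v then b else if l w \<le> Suc i then c w else transpose b e (c w))" for w
  have "nbrs V l c' u = nbrs V l c u"
  proof (rule recolor_nbrs_eq)
    show "c' w < k" if "w \<in> V" for w
      using that col_lt b(1) e(1) by (auto simp: c'_def transpose_def)
    have *: "c' y \<noteq> c' w" if wy: "w \<in> V" "y \<in> V" "c y \<noteq> c w" "l y \<le> l w" "l w \<le> Suc (l y)" for w y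
    proof -
      consider "l w \<le> Suc i" | "l y = Suc i" "l w = Suc (Suc i)" | "l y > Suc i"
        using wy by linarith
      then show ?thesis
      proof cases
        case 1
        then consider "l w < Suc i" | "l w = Suc i" "l y = Suc i" | "l w = Suc i" "l y = i"
          using wy by linarith
        then show ?thesis
          by cases (use wy uv b in \<open>auto simp: c'_def\<close>)
      next
        case 2
        then have w: "c w \<notin> c ` {w \<in> V. l w = Suc i}" "c w \<noteq> e"
          using wy dis e by auto
        have y: "c y \<in> c ` {w \<in> V. l w = Suc i}" using 2 wy by auto
        have "c' w = transpose b e (c w)" using 2 uv by (auto simp: c'_def)
        moreover have "c' y = (if y = v then b else c y)" using 2 by (auto simp: c'_def)
        ultimately show ?thesis using w y b e by (auto simp: transpose_def split: if_splits)
      next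
        case 3
        then show ?thesis using wy uv by (auto simp: c'_def dest: transpose_eq_imp_eq)
      qed
    qed
    show "nbrs V l c w \<subseteq> nbrs V l c' w" if "w \<in> V" for w
    proof
      fix y assume "y \<in> nbrs V l c w"
      then have y: "y \<in> V" "c y \<noteq> c w" "l y \<le> Suc (l w)" "l w \<le> Suc (l y)"
        by (auto simp: nbrs_def)
      have "c' y \<noteq> c' w"
        using *[OF that y(1,2)] *[OF y(1) that y(2)[symmetric]] y(3,4)
        by (metis linorder_linear)
      with y show "y \<in> nbrs V l c' w" by (simp add: nbrs_def)
    qed
  qed (fact uv)
  moreover have "v \<in> nbrs V l c' u"
    using uv b by (auto simp: nbrs_def c'_def)
  ultimately show False using uv by (auto simp: nbrs_def)
qed

section \<open>One-colored layers after full layers, behind (iii)\<close>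

lemma move_down:
  assumes "Suc (Suc (Suc j)) \<le> D"
    and high: "\<And>w. w \<in> V \<Longrightarrow> l w = Suc (Suc (Suc j)) \<Longrightarrow> c w = a"
    and other: "z \<in> V" "l z = Suc (Suc j)" "c z \<noteq> a"
    and u: "u \<in> V" "l u = Suc (Suc j)" "c u = a"
    and y: "y \<in> V" "l y = j"
  shows "c y = a"
proof (rule ccontr)
  assume ya: "c y \<noteq> a"
  \<comment> \<open>The vertices of color \<open>a\<close> in layer \<open>j + 2\<close> see nothing
    in layer \<open>j + 3\<close>, so lowering them loses no adjacency, and \<open>u\<close> gains
    \<open>y\<close>. Their new parent is \<open>y\<close>; \<open>z\<close> stays behind as parent
    for layer \<open>j + 3\<close>.\<close>
  define l' where "l' w = (if l w = Suc (Suc j) \<and> c w = a then Suc j else l w)" for w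
  have "nbrs V l' c u = nbrs V l c u"
  proof (rule nbrs_mono_eq)
    show "colored_layering V x k D l' c"
    proof unfold_locales
      show "l' w = 0 \<longleftrightarrow> w = x" if "w \<in> V" for w
        using root[OF that] by (auto simp: l'_def)
      show "l' w \<le> D" if "w \<in> V" for w
        using le_D[OF that] by (auto simp: l'_def)
      obtain w where "w \<in> V" "l w = D" using top by blast
      then show "\<exists>w\<in>V. l' w = D"
        using assms(1) other by (cases "D = Suc (Suc j)") (auto simp: l'_def intro!: bexI[of _ w])
      show "\<exists>p\<in>V. l' w = Suc (l' p) \<and> c p \<noteq> c w" if w: "w \<in> V" "l' w > 0" for w
      proof (cases "l w = Suc (Suc j) \<and> c w = a")
        case True
        then show ?thesis using y ya by (intro bexI[of _ y]) (auto simp: l'_def)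
      next
        case False
        then have lw: "l' w = l w" by (auto simp: l'_def)
        then obtain p where p: "p \<in> V" "l w = Suc (l p)" "c p \<noteq> c w" using parent w by auto
        show ?thesis
        proof (cases "l w = Suc (Suc (Suc j))")
          case True
          then show ?thesis using lw high w other by (intro bexI[of _ z]) (auto simp: l'_def)
        next
          case False
          then show ?thesis using lw p by (intro bexI[of _ p]) (auto simp: l'_def)
        qed
      qed
    qed (use fin x_in col_lt in auto)
    \<comment> \<open>One inequality suffices since \<open>nbrs\<close> is symmetric. As
      \<open>l'\<close> only lowers, it is in danger only if \<open>w\<close> itself drops.\<close>
    have *: "l' y \<le> Suc (l' w)" if "y \<in> V" "c y \<noteq> c w" "l y \<le> Suc (l w)" for w y
    proof (cases "l w = Suc (Suc j) \<and> c w = a")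
      case True
      then have "l y \<noteq> Suc (Suc (Suc j))" using that high by auto
      with True that have "l y \<le> Suc (Suc j)" by simp
      moreover have "l' y \<le> l y" by (simp add: l'_def)
      ultimately show ?thesis using True by (simp add: l'_def)
    next
      case False
      then have "l' w = l w" by (auto simp: l'_def)
      moreover have "l' y \<le> l y" by (simp add: l'_def)
      ultimately show ?thesis using that by simp
    qed
    show "nbrs V l c w \<subseteq> nbrs V l' c w" if "w \<in> V" for w
      using that by (auto simp: nbrs_def intro: *)
  qed (fact u)
  moreover have "y \<in> nbrs V l' c u"
    using u y ya by (auto simp: nbrs_def l'_def)
  ultimately show False using u y by (auto simp: nbrs_def)
qed

text \<open>
  Here \<open>P\<close> and \<open>M - P\<close> are the new layers \<open>j + 1\<close> and \<open>j + 2\<close>, while the layers \<open>j\<close> and \<open>j + 3\<close>, both of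
  color \<open>a\<close>, get the colors \<open>\<alpha>\<close> and \<open>\<beta>\<close>. Neighbors inside \<open>M\<close> depend on the color only, so by
  \<open>old\<close> and \<open>full\<close> each vertex of \<open>M\<close> with color different from \<open>a\<close> inherits its degree from a
  vertex of the same color in the original version of its new layer. The edge count grows
  because the vertices of color \<open>a\<close> in \<open>M\<close> had no neighbors outside \<open>M\<close>.
\<close>

lemma exchange:
  assumes D: "Suc (Suc (Suc j)) \<le> D"
    and low: "\<And>w. w \<in> V \<Longrightarrow> l w = j \<Longrightarrow> c w = a"
    and high: "\<And>w. w \<in> V \<Longrightarrow> l w = Suc (Suc (Suc j)) \<Longrightarrow> c w = a"
    and full: "c ` {w \<in> V. l w = Suc (Suc j)} = {..<k}"
    and lt: "a < k" "\<alpha> < k" "\<beta> < k"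
    and M_def: "M = {w \<in> V. l w = Suc j \<or> l w = Suc (Suc j)}"
    and P: "P \<subseteq> M" "M - P \<noteq> {}"
    and \<alpha>: "\<alpha> \<notin> c ` P" and \<beta>: "\<beta> \<notin> c ` (M - P)"
    and par: "\<And>v. v \<in> M - P \<Longrightarrow> \<exists>u\<in>P. c u \<noteq> c v"
    and card_P: "card {v \<in> P. c v \<noteq> a} = card {w \<in> V. l w = Suc j}"
    and old: "\<And>v. v \<in> P \<Longrightarrow> c v \<noteq> a \<Longrightarrow> \<exists>u\<in>V. l u = Suc j \<and> c u = c v"
  shows False
proof -
  define l' where "l' w = (if w \<in> P then Suc j else if w \<in> M then Suc (Suc j) else l w)" for w
  \<comment> \<open>Each transposition acts on a whole side of \<open>M\<close>, so adjacencies
    outside \<open>M\<close> are untouched.\<close>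
  define c' where "c' w = (if w \<in> M then c w else if l w \<le> j then transpose a \<alpha> (c w)
    else transpose a \<beta> (c w))" for w
  let ?N = "nbrs V l c" and ?N' = "nbrs V l' c'"
  define inner where "inner v = card {u \<in> M. c u \<noteq> c v}" for v
  define n1 where "n1 = card {w \<in> V. l w = j}"
  define n2 where "n2 = card {w \<in> V. l w = Suc (Suc (Suc j))}"
  have MV: "M \<subseteq> V" by (auto simp: M_def)
  have finM: "finite M" using fin MV by (rule finite_subset[rotated])
  have l'P: "l' w = Suc j" if "w \<in> P" for w using that by (simp add: l'_def)
  have l'Q: "l' w = Suc (Suc j)" if "w \<in> M" "w \<notin> P" for w using that by (simp add: l'_def)
  have l'o: "l' w = l w" if "w \<notin> M" for w using that P by (auto simp: l'_def)
  have c'M: "c' w = c w" if "w \<in> M" for w using that by (simp add: c'_def)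
  have outside: "l w \<le> j \<or> Suc (Suc (Suc j)) \<le> l w" if "w \<in> V" "w \<notin> M" for w
    using that by (auto simp: M_def)
  have c'low: "c' w = transpose a \<alpha> (c w)" if "w \<in> V" "l w \<le> j" for w
    using that by (auto simp: c'_def M_def)
  have c'high: "c' w = transpose a \<beta> (c w)" if "w \<in> V" "Suc (Suc (Suc j)) \<le> l w" for w
    using that by (auto simp: c'_def M_def)
  \<comment> \<open>Hence the vertices of color \<open>a\<close> in \<open>M\<close> all come from
    layer \<open>j + 2\<close>.\<close>
  have P0: "c v \<noteq> a" if "v \<in> V" "l v = Suc j" for v
    using parent[OF that(1)] that low by auto
  have c'\<alpha>: "c' w = \<alpha>" if "w \<in> V" "l w = j" for w
    using that c'low low by simp
  have c'\<beta>: "c' w = \<beta>" if "w \<in> V" "l w = Suc (Suc (Suc j))" for w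
    using that c'high high by simp

  have \<alpha>P: "c w \<noteq> \<alpha>" if "w \<in> P" for w using that \<alpha> by auto
  have \<beta>Q: "c w \<noteq> \<beta>" if "w \<in> M" "w \<notin> P" for w using that \<beta> by auto

  have pos: "0 < n1" "0 < n2"
    using layer_nonempty[of j] layer_nonempty[of "Suc (Suc (Suc j))"] D fin
    by (auto simp: n1_def n2_def card_gt_0_iff)

  have N_P0: "card (?N v) = inner v + n1" if v: "v \<in> V" "l v = Suc j" for v
  proof -
    have "?N v = {u \<in> M. c u \<noteq> c v} \<union> {w \<in> V. l w = j}"
      using v P0[OF v] low by (auto simp: nbrs_def M_def)
    then show ?thesis
      using finM fin by (auto simp: inner_def n1_def M_def intro!: card_Un_disjoint)
  qed
  have N_Q0: "card (?N v) = inner v + n2" if v: "v \<in> V" "l v = Suc (Suc j)" "c v \<noteq> a" for v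
  proof -
    have "?N v = {u \<in> M. c u \<noteq> c v} \<union> {w \<in> V. l w = Suc (Suc (Suc j))}"
      using v high by (auto simp: nbrs_def M_def)
    then show ?thesis
      using finM fin by (auto simp: inner_def n2_def M_def intro!: card_Un_disjoint)
  qed
  have N_A: "card (?N v) = inner v" if v: "v \<in> M" "c v = a" for v
  proof -
    have "l u \<noteq> Suc (Suc (Suc j))" if "u \<in> V" "c u \<noteq> c v" for u
      using high that v by auto
    then have "?N v = {u \<in> M. c u \<noteq> c v}"
      using v P0 by (fastforce simp: nbrs_def M_def)
    then show ?thesis by (simp add: inner_def)
  qed
  \<comment> \<open>As \<alpha> is missing in \<open>P\<close>, every vertex of \<open>P\<close>,
    even one of color \<open>a\<close>, sees all of layer \<open>j\<close>.\<close>
  have N'_P: "card (?N' v) = inner v + n1" if v: "v \<in> P" for v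
  proof -
    have vM: "v \<in> M" using v P by auto
    have "u \<in> ?N' v \<longleftrightarrow> u \<in> {u \<in> M. c u \<noteq> c v} \<union> {w \<in> V. l w = j}" for u
    proof (cases "u \<in> M")
      case True
      then show ?thesis
        using MV v vM by (cases "u \<in> P") (auto simp: nbrs_def l'P l'Q c'M M_def)
    next
      case False
      then show ?thesis
        using v vM \<alpha> outside[of u] c'\<alpha>[of u]
        by (auto simp: nbrs_def l'P l'o c'M)
    qed
    then have "?N' v = {u \<in> M. c u \<noteq> c v} \<union> {w \<in> V. l w = j}" by blast
    then show ?thesis
      using finM fin by (auto simp: inner_def n1_def M_def intro!: card_Un_disjoint)
  qed
  have N'_Q: "card (?N' v) = inner v + n2" if v: "v \<in> M" "v \<notin> P" for v
  proof -
    have "u \<in> ?N' v \<longleftrightarrow> u \<in> {u \<in> M. c u \<noteq> c v} \<union> {w \<in> V. l w = Suc (Suc (Suc j))}" for u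
    proof (cases "u \<in> M")
      case True
      then show ?thesis
        using MV v by (cases "u \<in> P") (auto simp: nbrs_def l'P l'Q c'M M_def)
    next
      case False
      then show ?thesis
        using v \<beta> outside[of u] c'\<beta>[of u]
        by (auto simp: nbrs_def l'Q l'o c'M)
    qed
    then have "?N' v = {u \<in> M. c u \<noteq> c v} \<union> {w \<in> V. l w = Suc (Suc (Suc j))}" by blast
    then show ?thesis
      using finM fin by (auto simp: inner_def n2_def M_def intro!: card_Un_disjoint)
  qed

  define P0 where "P0 = {w \<in> V. l w = Suc j}"
  define B where "B = {v \<in> M. c v \<noteq> a}"
  define A where "A = {v \<in> M. c v = a}"
  have P0B: "P0 \<subseteq> B" using P0 by (auto simp: P0_def B_def M_def)
  have finB: "finite B" using finM by (simp add: B_def)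
  have P1: "B \<inter> P = {v \<in> P. c v \<noteq> a}" using P by (auto simp: B_def)
  have cP: "card (B \<inter> P) = card (B \<inter> P0)"
    using card_P P0B by (simp add: P1 P0_def Int_absorb1)
  have cQ: "card (B - P) = card (B - P0)"
    using cP finB by (metis card_Diff_subset_Int finite_Int)
  have cA: "A \<noteq> {}"
  proof -
    have "a \<in> c ` {w \<in> V. l w = Suc (Suc j)}" using full lt by simp
    then show ?thesis by (auto simp: A_def M_def)
  qed

  have out: "card (?N v) \<le> card (?N' v)" if v: "v \<in> V" "v \<notin> M" for v
  proof -
    \<comment> \<open>Neighbors outside \<open>M\<close> lie on the same side of \<open>M\<close> as
      \<open>v\<close>, where one transposition permutes the colors.\<close>
    have "?N v - M = ?N' v - M"
    proof -
      have "c' u = c' v \<longleftrightarrow> c u = c v"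
        if "u \<in> V" "u \<notin> M" "l u \<le> Suc (l v)" "l v \<le> Suc (l u)" for u
      proof (cases "l v \<le> j")
        case True
        then have "l u \<le> j" using outside that by fastforce
        with True show ?thesis
          using that v c'low by (auto dest: transpose_eq_imp_eq)
      next
        case False
        then have "Suc (Suc (Suc j)) \<le> l v" "Suc (Suc (Suc j)) \<le> l u"
          using outside[of v] outside[of u] that v by linarith+
        then show ?thesis
          using that v c'high by (auto dest: transpose_eq_imp_eq)
      qed
      then show ?thesis using v by (auto simp: nbrs_def l'o)
    qed
    \<comment> \<open>Only layers \<open>j\<close> and \<open>j + 3\<close> see \<open>M\<close>.
      Their vertices saw at most the colors other than \<open>a\<close> in the adjacent layer; now
      they see all vertices of such colors in the new one, which are equally many.\<close>
    moreover have "card (?N v \<inter> M) \<le> card (?N' v \<inter> M)"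
    proof -
      consider "l v < j" | "l v = j" | "l v = Suc (Suc (Suc j))" | "l v > Suc (Suc (Suc j))"
        using outside[OF v] by linarith
      then show ?thesis
      proof cases
        case 1
        then have "?N v \<inter> M = {}" by (auto simp: nbrs_def M_def)
        then show ?thesis by simp
      next
        case 2
        have "?N v \<inter> M \<subseteq> P0" using 2 by (auto simp: nbrs_def M_def P0_def)
        then have "card (?N v \<inter> M) \<le> card (B \<inter> P)"
          using fin P0B cP by (auto simp: P0_def Int_absorb1 intro!: card_mono)
        moreover have "B \<inter> P \<subseteq> ?N' v \<inter> M"
          using 2 v MV c'\<alpha>[of v] by (auto simp: nbrs_def l'P l'o c'M B_def dest: \<alpha>P)
        then have "card (B \<inter> P) \<le> card (?N' v \<inter> M)"
          using finM by (intro card_mono) auto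
        ultimately show ?thesis by simp
      next
        case 3
        have "?N v \<inter> M \<subseteq> B - P0" using 3 v high by (auto simp: nbrs_def M_def P0_def B_def)
        then have "card (?N v \<inter> M) \<le> card (B - P)"
          using finB cQ by (auto intro!: card_mono)
        moreover have "B - P \<subseteq> ?N' v \<inter> M"
          using 3 v MV c'\<beta>[of v] by (auto simp: nbrs_def l'Q l'o c'M B_def dest: \<beta>Q)
        then have "card (B - P) \<le> card (?N' v \<inter> M)"
          using finM by (intro card_mono) auto
        ultimately show ?thesis by simp
      next
        case 4
        then have "?N v \<inter> M = {}" by (auto simp: nbrs_def M_def)
        then show ?thesis by simp
      qed
    qed
    moreover have "card (nbrs V f g v) = card (nbrs V f g v - M) + card (nbrs V f g v \<inter> M)" for f g
      using finite_nbrs[of f g v] by (metis add.commute card_Int_Diff)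
    ultimately show ?thesis by simp
  qed

  have in_A: "card (?N v) < card (?N' v)" if "v \<in> A" for v
    using that N_A[of v] N'_P[of v] N'_Q[of v] pos by (cases "v \<in> P") (auto simp: A_def)

  have valid: "colored_layering V x k D l' c'"
  proof unfold_locales
    show "l' w = 0 \<longleftrightarrow> w = x" if "w \<in> V" for w
      using root[OF that] by (auto simp: l'_def M_def dest: set_mp[OF P(1)])
    show "l' w \<le> D" if "w \<in> V" for w
      using le_D[OF that] D by (auto simp: l'_def)
    show "c' w < k" if "w \<in> V" for w
      using col_lt[OF that] lt by (auto simp: c'_def transpose_def)
    obtain w where w: "w \<in> V" "l w = D" using top by blast
    then have "w \<notin> M" using D by (auto simp: M_def)
    with w show "\<exists>w\<in>V. l' w = D" using l'o by auto
    show "\<exists>p\<in>V. l' w = Suc (l' p) \<and> c' p \<noteq> c' w" if w: "w \<in> V" "l' w > 0" for w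
    proof -
      consider "w \<in> P" | "w \<in> M" "w \<notin> P" | "w \<notin> M" "l w \<le> j" | "l w = Suc (Suc (Suc j))"
        | "w \<notin> M" "l w > Suc (Suc (Suc j))"
        using outside[OF w(1)] by fastforce
      then show ?thesis
      proof cases
        case 1
        obtain p where p: "p \<in> V" "l p = j" using layer_nonempty[of j] D by auto
        then have "p \<notin> M" by (auto simp: M_def)
        with 1 p \<alpha> P show ?thesis
          by (intro bexI[of _ p]) (auto simp: l'P l'o c'M c'\<alpha>)
      next
        case 2
        then obtain p where "p \<in> P" "c p \<noteq> c w" using par by auto
        with 2 P MV show ?thesis
          by (intro bexI[of _ p]) (auto simp: l'P l'Q c'M)
      next
        case 3
        then obtain p where p: "p \<in> V" "l w = Suc (l p)" "c p \<noteq> c w"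
          using parent w l'o by auto
        moreover have "p \<notin> M" using p 3 by (auto simp: M_def)
        ultimately show ?thesis using 3 w
          by (intro bexI[of _ p]) (auto simp: l'o c'low dest: transpose_eq_imp_eq)
      next
        case 4
        then have "w \<notin> M" by (auto simp: M_def)
        \<comment> \<open>Any vertex of \<open>M - P\<close> can be the parent, since it avoids
          \<beta>, the new color of \<open>w\<close>.\<close>
        obtain p where "p \<in> M" "p \<notin> P" using P by auto
        moreover from this have "c p \<noteq> \<beta>" using \<beta> by auto
        ultimately show ?thesis using 4 w MV \<open>w \<notin> M\<close>
          by (intro bexI[of _ p]) (auto simp: l'Q l'o c'M c'\<beta>)
      next
        case 5
        then obtain p where p: "p \<in> V" "l w = Suc (l p)" "c p \<noteq> c w"
          using parent[of w] w(1) by auto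
        moreover have "p \<notin> M" using p 5 by (auto simp: M_def)
        ultimately show ?thesis using 5 w
          by (intro bexI[of _ p]) (auto simp: l'o c'high dest: transpose_eq_imp_eq)
      qed
    qed
  qed (use fin x_in in auto)

  have inner_eq: "inner v = inner u" if "c v = c u" for u v
    using that by (simp add: inner_def)
  have "\<delta> \<le> card (?N' v)" if v: "v \<in> V" for v
  proof -
    consider "v \<notin> M" | "v \<in> A" | "v \<in> B" "v \<in> P" | "v \<in> B" "v \<notin> P"
      by (auto simp: A_def B_def)
    then show ?thesis
    proof cases
      case 1 then show ?thesis using out[OF v] deg[OF v] by simp
    next
      case 2 then show ?thesis using in_A deg[OF v] by fastforce
    next
      case 3
      then obtain u where "u \<in> V" "l u = Suc j" "c u = c v" using old by (auto simp: B_def)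
      then show ?thesis using N_P0[of u] N'_P[of v] 3 deg[of u] inner_eq[of u v] by simp
    next
      case 4
      have "c v \<in> c ` {w \<in> V. l w = Suc (Suc j)}" using full col_lt v by simp
      then obtain u where "u \<in> V" "l u = Suc (Suc j)" "c u = c v" by auto
      then show ?thesis
        using N_Q0[of u] N'_Q[of v] 4 deg[of u] inner_eq[of u v] by (simp add: B_def)
    qed
  qed
  from maximal[OF valid this]
  have le: "(\<Sum>v\<in>V. card (?N' v)) \<le> (\<Sum>v\<in>V. card (?N v))" by simp
  have split: "(\<Sum>v\<in>V. f v) = (\<Sum>v\<in>V - M. f v) + ((\<Sum>v\<in>A. f v) + (\<Sum>v\<in>B. f v))" for f :: "'a \<Rightarrow> nat"
  proof -
    have "V = (V - M) \<union> (A \<union> B)" using MV by (auto simp: A_def B_def)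
    then have "sum f V = sum f ((V - M) \<union> (A \<union> B))" by simp
    also have "\<dots> = sum f (V - M) + sum f (A \<union> B)"
      using fin finM by (intro sum.union_disjoint) (auto simp: A_def B_def)
    also have "sum f (A \<union> B) = sum f A + sum f B"
      using finM by (intro sum.union_disjoint) (auto simp: A_def B_def)
    finally show ?thesis .
  qed
  \<comment> \<open>The sum over \<open>B\<close> depends only on how many elements of
    \<open>B\<close> lie in each layer, so it does not change; the strict gain comes from
    \<open>A\<close>.\<close>
  have sumB: "(\<Sum>v\<in>B. inner v + (if v \<in> S then n1 else n2))
      = (\<Sum>v\<in>B. inner v) + card (B \<inter> S) * n1 + card (B - S) * n2" for S
    using finB by (simp add: sum.distrib sum.If_cases Diff_eq)
  have "(\<Sum>v\<in>B. card (?N' v)) = (\<Sum>v\<in>B. inner v + (if v \<in> P then n1 else n2))"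
    using N'_P N'_Q by (intro sum.cong) (auto simp: B_def)
  moreover have "(\<Sum>v\<in>B. card (?N v)) = (\<Sum>v\<in>B. inner v + (if v \<in> P0 then n1 else n2))"
    using N_P0 N_Q0 by (intro sum.cong) (auto simp: B_def P0_def M_def)
  ultimately have "(\<Sum>v\<in>B. card (?N' v)) = (\<Sum>v\<in>B. card (?N v))"
    using cP cQ by (simp only: sumB)
  moreover have "(\<Sum>v\<in>A. card (?N v)) < (\<Sum>v\<in>A. card (?N' v))"
    using cA in_A finM by (intro sum_strict_mono) (auto simp: A_def)
  moreover have "(\<Sum>v\<in>V - M. card (?N v)) \<le> (\<Sum>v\<in>V - M. card (?N' v))"
    using out by (intro sum_mono) auto
  ultimately show False using le by (simp only: split)
qed

text \<open>It suffices to find a \<open>P\<close> for \<open>exchange\<close>. Either layer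
  \<open>j + 1\<close> lacks a color other than \<open>a\<close>, or all such colors occur in both
  layers; then \<open>old\<close> holds for every choice of \<open>P\<close> and only sizes
  matter.\<close>

lemma full_layer_next:
  assumes k: "3 \<le> k" and D: "Suc (Suc (Suc j)) \<le> D"
    and full: "c ` {w \<in> V. l w = Suc (Suc j)} = {..<k}"
    and high: "\<And>w. w \<in> V \<Longrightarrow> l w = Suc (Suc (Suc j)) \<Longrightarrow> c w = a"
  shows False
proof -
  define L1 where "L1 = {w \<in> V. l w = Suc j}"
  define M where "M = {w \<in> V. l w = Suc j \<or> l w = Suc (Suc j)}"
  define A where "A = {w \<in> M. c w = a}"
  define S where "S = {w \<in> M. c w \<noteq> a}"
  have a: "a < k" using layer_nonempty[OF D] high col_lt by blast
  have full': "\<exists>w\<in>V. l w = Suc (Suc j) \<and> c w = b" if "b < k" for b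
  proof -
    have "b \<in> c ` {w \<in> V. l w = Suc (Suc j)}" using that full by simp
    then show ?thesis by auto
  qed
  \<comment> \<open>Two of the colors 0, 1, 2 differ from \<open>a\<close>; \<open>3 \<le> k\<close>
    enters here.\<close>
  obtain b d where bd: "b \<noteq> d" "b < k" "d < k" "b \<noteq> a" "d \<noteq> a"
  proof
    show "(if a = 0 then 1 else 0) \<noteq> (if a = 2 then 1 else 2 :: nat)"
      "(if a = 0 then 1 else 0) < k" "(if a = 2 then 1 else 2) < k"
      "(if a = 0 then 1 else 0) \<noteq> a" "(if a = 2 then 1 else 2) \<noteq> a"
      using k by auto
  qed
  obtain u z where uz: "u \<in> V" "l u = Suc (Suc j)" "c u = a" "z \<in> V" "l z = Suc (Suc j)" "c z = b"
    using full'[OF a] full'[OF bd(2)] by blast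
  have low: "c w = a" if "w \<in> V" "l w = j" for w
    using move_down[OF D high, of z u w] uz that bd by auto
  have L1a: "c v \<noteq> a" if "v \<in> V" "l v = Suc j" for v
    using parent[OF that(1)] that low by auto
  have uA: "u \<in> A" using uz by (auto simp: A_def M_def)
  have L1S: "L1 \<subseteq> S" "L1 \<subseteq> M" using L1a by (auto simp: L1_def S_def M_def)
  have finS: "finite S" using fin by (auto simp: S_def M_def)
  note ex = exchange[OF D _ _ full a _ _ M_def]
  show False
  proof (cases "\<exists>b<k. b \<noteq> a \<and> b \<notin> c ` L1")
    case True
    then obtain b' where b': "b' < k" "b' \<noteq> a" "b' \<notin> c ` L1" by blast
    \<comment> \<open>Layer \<open>j + 1\<close> already avoids \<open>b'\<close>, so nothing but the color class of \<open>a\<close> has to move.\<close>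
    have nonA: "{v \<in> L1 \<union> A. c v \<noteq> a} = L1" using L1S by (auto simp: A_def S_def)
    show False
    \<comment> \<open>Here \<alpha> is \<open>b'\<close> and \<beta> is \<open>a\<close>: layer
      \<open>j + 3\<close> keeps its color, since \<open>a\<close> has left the new layer
      \<open>j + 2\<close>.\<close>
    proof (rule ex[OF _ _ b'(1) a, where P = "L1 \<union> A"])
      show "M - (L1 \<union> A) \<noteq> {}" using uz bd by (auto simp: M_def L1_def A_def)
      show "\<exists>u\<in>L1 \<union> A. c u \<noteq> c v" if "v \<in> M - (L1 \<union> A)" for v
        using that uA by (intro bexI[of _ u]) (auto simp: A_def)
      show "\<exists>u\<in>V. l u = Suc j \<and> c u = c v" if "v \<in> L1 \<union> A" "c v \<noteq> a" for v
        using that by (auto simp: A_def L1_def)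
      show "L1 \<union> A \<subseteq> M" using b' L1S uA L1S by (auto simp: A_def M_def)
      show "b' \<notin> c ` (L1 \<union> A)" using b' L1S uA by (auto simp: A_def)
      show "a \<notin> c ` (M - (L1 \<union> A))" using b' L1S uA by (auto simp: A_def)
      show "card {v \<in> L1 \<union> A. c v \<noteq> a} = card {w \<in> V. l w = Suc j}"
        using nonA by (simp flip: L1_def)
    qed (fact low high)+
  next
    case False
    then have all: "\<exists>u\<in>V. l u = Suc j \<and> c u = e" if "e < k" "e \<noteq> a" for e
      using that by (auto simp: L1_def)
    have old: "\<exists>u\<in>V. l u = Suc j \<and> c u = c v" if "v \<in> M" "c v \<noteq> a" for v
      using all[OF _ that(2)] col_lt that by (auto simp: M_def)
    define Sb where "Sb = {w \<in> S. c w = b}"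
    define Sd where "Sd = {w \<in> S. c w = d}"
    define q where "q = card (S - L1)"
    have cS: "card S = card L1 + q"
      using finS L1S by (simp add: q_def card_Diff_subset finite_subset card_mono)
    have sub: "Sb \<subseteq> S" "Sd \<subseteq> S" by (auto simp: Sb_def Sd_def)
    then have fins: "finite Sb" "finite Sd" using finS finite_subset by auto
    have "card Sb + card Sd = card (Sb \<union> Sd)"
      using fins bd by (intro card_Un_disjoint[symmetric]) (auto simp: Sb_def Sd_def)
    also have "\<dots> \<le> card S" using finS sub by (intro card_mono) auto
    finally have le: "card Sb + card Sd \<le> card L1 + q" using cS by simp
    \<comment> \<open>Hence \<open>Sb\<close> fits into layer \<open>j + 2\<close> or \<open>Sd\<close> fits into layer \<open>j + 1\<close>.\<close>
    show False
    proof (cases "card Sb \<le> q")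
      case True
      then have "card L1 \<le> card (S - Sb)"
        using cS sub fins by (simp add: card_Diff_subset)
      \<comment> \<open>With \<open>A\<close> added, \<open>P\<close> becomes layer
        \<open>j + 1\<close> and avoids \<open>b\<close>; layer \<open>j\<close> turns to
        \<open>b\<close>.\<close>
      then obtain P where P: "P \<subseteq> S - Sb" "card P = card L1"
        by (metis obtain_subset_with_card_n)
      have nonA: "{v \<in> P \<union> A. c v \<noteq> a} = P" using P by (auto simp: A_def S_def)
      show False
      proof (rule ex[OF _ _ bd(2) a, where P = "P \<union> A"])
        show "M - (P \<union> A) \<noteq> {}"
          using uz bd P by (auto simp: M_def S_def Sb_def A_def)
        show "\<exists>u\<in>P \<union> A. c u \<noteq> c v" if "v \<in> M - (P \<union> A)" for v
          using that uA by (intro bexI[of _ u]) (auto simp: A_def)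
        show "\<exists>u\<in>V. l u = Suc j \<and> c u = c v" if "v \<in> P \<union> A" "c v \<noteq> a" for v
          using that P old[of v] by (auto simp: A_def S_def)
        show "P \<union> A \<subseteq> M" using P bd L1S by (auto simp: A_def S_def Sb_def M_def)
        show "b \<notin> c ` (P \<union> A)" using P bd by (auto simp: A_def S_def Sb_def)
        show "a \<notin> c ` (M - (P \<union> A))" using P bd by (auto simp: A_def S_def Sb_def)
        show "card {v \<in> P \<union> A. c v \<noteq> a} = card {w \<in> V. l w = Suc j}"
          using nonA P(2) by (simp flip: L1_def)
      qed (fact low high)+
    next
      case False
      with le have "card Sd \<le> card L1" by simp
      then have "q \<le> card (S - Sd)"
        using cS sub fins by (simp add: card_Diff_subset)
      \<comment> \<open>The mirror choice: with \<open>A\<close> added, \<open>Q\<close> becomes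
        layer \<open>j + 2\<close> and avoids \<open>d\<close>; layer \<open>j + 3\<close> turns to
        \<open>d\<close>.\<close>
      then obtain Q where Q: "Q \<subseteq> S - Sd" "card Q = q"
        by (metis obtain_subset_with_card_n)
      have cP: "card (S - Q) = card L1"
        using Q cS finS finite_subset[of Q S] by (subst card_Diff_subset) auto
      have nonA: "{v \<in> S - Q. c v \<noteq> a} = S - Q" by (auto simp: S_def)
      \<comment> \<open>As \<open>Q\<close> avoids color \<open>d\<close>, \<open>y\<close> ends up
        in layer \<open>j + 1\<close> and is a parent for the whole new layer
        \<open>j + 2\<close>.\<close>
      obtain y where y: "y \<in> V" "l y = Suc j" "c y = d" using all bd by blast
      then have yS: "y \<in> S - Q" using Q bd by (auto simp: S_def M_def Sd_def)
      show False
      proof (rule ex[OF _ _ a bd(3), where P = "S - Q"])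
        show "M - (S - Q) \<noteq> {}" using uA by (auto simp: A_def S_def)
        show "\<exists>u\<in>S - Q. c u \<noteq> c v" if "v \<in> M - (S - Q)" for v
          using that yS y Q bd by (intro bexI[of _ y]) (auto simp: S_def Sd_def)
        show "\<exists>u\<in>V. l u = Suc j \<and> c u = c v" if "v \<in> S - Q" "c v \<noteq> a" for v
          using that old[of v] by (auto simp: S_def)
        show "S - Q \<subseteq> M" using Q bd L1S by (auto simp: S_def Sd_def M_def)
        show "a \<notin> c ` (S - Q)" using Q bd by (auto simp: S_def Sd_def)
        show "d \<notin> c ` (M - (S - Q))" using Q bd by (auto simp: S_def Sd_def)
        show "card {v \<in> S - Q. c v \<noteq> a} = card {w \<in> V. l w = Suc j}"
          using nonA cP by (simp flip: L1_def)
      qed (fact low high)+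
    qed
  qed
qed

section \<open>The four properties of a maximal layering\<close>

lemma canonical:
  assumes k: "3 \<le> k" and i: "i < D"
  defines "L \<equiv> \<lambda>j. {w \<in> V. l w = j}"
  shows "card (c ` L i) = 1 \<Longrightarrow> card (c ` L (Suc i)) \<le> k - 1"
    and "card (c ` (L i \<union> L (Suc i))) = min k (card (c ` L i) + card (c ` L (Suc i)))"
    and "card (c ` L i) + card (c ` L (Suc i)) \<le> k \<Longrightarrow> c ` L i \<inter> c ` L (Suc i) = {}"
    and "card (c ` L i) = k \<Longrightarrow> 2 \<le> i \<and> 2 \<le> card (c ` L (Suc i))"
    and "card (c ` L i) < card (L i) \<Longrightarrow>
      0 < i \<and> k \<le> card (c ` L i) + max (card (c ` L (i - 1))) (card (c ` L (Suc i)))"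
proof -
  have finL: "finite (L j)" for j using fin by (simp add: L_def)
  have sub: "c ` L j \<subseteq> {..<k}" for j using col_lt by (auto simp: L_def)
  have ne: "L j \<noteq> {}" if "j \<le> D" for j using layer_nonempty[OF that] by (auto simp: L_def)
  have L0: "L 0 = {x}" using root x_in by (auto simp: L_def)
  \<comment> \<open>A vertex of layer \<open>j + 1\<close> repeating the only color of layer
    \<open>j\<close> would have no parent. The general \<open>j\<close> serves (iii), which uses
    \<open>j = 0\<close>.\<close>
  have single: "card (c ` L (Suc j)) \<le> k - 1" if one: "card (c ` L j) = 1" for j
  proof -
    obtain a where a: "c ` L j = {a}" using one card_1_singletonE by blast
    then have "a < k" using sub[of j] by simp
    have "a \<notin> c ` L (Suc j)"
    proof
      assume "a \<in> c ` L (Suc j)"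
      then obtain v where v: "v \<in> V" "l v = Suc j" "c v = a" by (auto simp: L_def)
      then obtain u where "u \<in> V" "l u = j" "c u \<noteq> a" using parent[of v] by auto
      then show False using a by (auto simp: L_def)
    qed
    then have "c ` L (Suc j) \<subseteq> {..<k} - {a}" using sub by auto
    then have "card (c ` L (Suc j)) \<le> card ({..<k} - {a})" by (intro card_mono) auto
    then show ?thesis using \<open>a < k\<close> by simp
  qed
  show "card (c ` L (Suc i)) \<le> k - 1" if "card (c ` L i) = 1"
    using that by (rule single)

  have meet: "c ` L j \<union> c ` L (Suc j) = {..<k}" if common: "c ` L j \<inter> c ` L (Suc j) \<noteq> {}" for j
  proof -
    obtain u v where "u \<in> L j" "v \<in> L (Suc j)" "c u = c v"
      using common by blast
    then show ?thesis
      unfolding L_def by (intro consecutive_colors[of u j v]) simp_all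
  qed
  have sum: "card (c ` L j) + card (c ` L (Suc j))
      = card (c ` (L j \<union> L (Suc j))) + card (c ` L j \<inter> c ` L (Suc j))" for j
    unfolding image_Un using finL by (intro card_Un_Int) auto
  \<comment> \<open>A shared color makes the union all \<open>k\<close> colors by
    \<open>meet\<close>; by inclusion-exclusion the sum then exceeds \<open>k\<close>.\<close>
  have disj: "c ` L j \<inter> c ` L (Suc j) = {}"
    if "card (c ` L j) + card (c ` L (Suc j)) \<le> k" for j
  proof (rule ccontr)
    assume m: "c ` L j \<inter> c ` L (Suc j) \<noteq> {}"
    then have "0 < card (c ` L j \<inter> c ` L (Suc j))" using finL by (simp add: card_gt_0_iff)
    then show False using sum[of j] meet[OF m] that by (simp add: image_Un)
  qed
  show "c ` L i \<inter> c ` L (Suc i) = {}" if "card (c ` L i) + card (c ` L (Suc i)) \<le> k"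
    using that by (rule disj)
  show "card (c ` (L i \<union> L (Suc i))) = min k (card (c ` L i) + card (c ` L (Suc i)))"
  proof (cases "c ` L i \<inter> c ` L (Suc i) = {}")
    case True
    have "card (c ` (L i \<union> L (Suc i))) \<le> card {..<k}"
      using sub by (intro card_mono) auto
    then show ?thesis using sum[of i] True by simp
  next
    case False
    then show ?thesis using sum[of i] meet[OF False] by (simp add: image_Un)
  qed

  show "2 \<le> i \<and> 2 \<le> card (c ` L (Suc i))" if full: "card (c ` L i) = k"
  proof -
    have "i \<noteq> 0" using full k L0 by (cases "i = 0") auto
    moreover have "i \<noteq> 1" using full k L0 single[of 0] by (cases "i = 1") auto
    ultimately have i2: "2 \<le> i" by simp
    then obtain j where j: "i = Suc (Suc j)" by (metis add_2_eq_Suc le_Suc_ex)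
    have eq: "c ` L i = {..<k}" using full sub by (intro card_subset_eq) auto
    have "card (c ` L (Suc i)) \<noteq> 0" using ne[of "Suc i"] i finL by simp
    moreover have "card (c ` L (Suc i)) \<noteq> 1"
    proof
      assume "card (c ` L (Suc i)) = 1"
      then obtain a where "c ` L (Suc i) = {a}" using card_1_singletonE by blast
      then show False
        using full_layer_next[OF k, of j a] eq i by (auto simp: j L_def)
    qed
    ultimately show ?thesis using i2 by simp
  qed

  show "0 < i \<and> k \<le> card (c ` L i) + max (card (c ` L (i - 1))) (card (c ` L (Suc i)))"
    if rep: "card (c ` L i) < card (L i)"
  proof -
    have "i \<noteq> 0" using rep L0 by (cases "i = 0") auto
    then obtain j where j: "i = Suc j" by (cases i) auto
    have "k \<le> card (c ` L i) + max (card (c ` L j)) (card (c ` L (Suc i)))"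
    proof (rule ccontr)
      assume less: "\<not> ?thesis"
      have "\<not> inj_on c (L i)" using rep card_image[of c "L i"] by auto
      then obtain u v where uv: "u \<in> L i" "v \<in> L i" "u \<noteq> v" "c u = c v"
        by (auto simp: inj_on_def)
      have "\<exists>b<k. b \<notin> c ` L m \<union> c ` L i" if "card (c ` L m) + card (c ` L i) < k" for m
      proof (rule ccontr)
        assume "\<not> ?thesis"
        then have "{..<k} \<subseteq> c ` L m \<union> c ` L i" by auto
        then have "card {..<k} \<le> card (c ` L m \<union> c ` L i)" using finL by (intro card_mono) auto
        also have "\<dots> \<le> card (c ` L m) + card (c ` L i)" by (rule card_Un_le)
        finally show False using that by simp
      qed
      moreover have "card (c ` L j) + card (c ` L i) < k" "card (c ` L (Suc i)) + card (c ` L i) < k"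
        using less by auto
      ultimately obtain b e
        where "b < k" "b \<notin> c ` L j \<union> c ` L i" "e < k" "e \<notin> c ` L (Suc i) \<union> c ` L i"
        by meson
      moreover have "c ` L i \<inter> c ` L (Suc i) = {}" using less by (intro disj) simp
      ultimately show False
        using repeated_color[of u v j b e] uv by (simp add: j L_def)
    qed
    then show ?thesis by (simp add: j)
  qed
qed

end

section \<open>Walks as powers of the arc relation\<close>

lemma relpow_sym:
  assumes "sym R" "(u, v) \<in> R ^^ n"
  shows "(v, u) \<in> R ^^ n"
  using assms(2)
proof (induction n arbitrary: v)
  case (Suc n)
  then obtain w where "(u, w) \<in> R ^^ n" "(w, v) \<in> R" by auto
  then show ?case using Suc.IH assms(1) by (meson relpow_Suc_I2 symD)
qed simp

context pair_wf_digraph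
begin

lemma awalk_length_iff_relpow:
  "u \<in> pverts G \<Longrightarrow> (\<exists>p. awalk u p v \<and> length p = n) \<longleftrightarrow> (u, v) \<in> parcs G ^^ n"
proof (induction n arbitrary: u)
  case 0
  then show ?case by (auto simp: awalk_Nil_iff)
next
  case (Suc n)
  have "(\<exists>p. awalk u p v \<and> length p = Suc n) \<longleftrightarrow>
      (\<exists>w. (u, w) \<in> parcs G \<and> (\<exists>p. awalk w p v \<and> length p = n))"
  proof
    assume "\<exists>p. awalk u p v \<and> length p = Suc n"
    then obtain e p where "awalk u (e # p) v" "length p = n" by (metis length_Suc_conv)
    then have "(u, snd e) \<in> parcs G" "awalk (snd e) p v" by (auto simp: awalk_Cons_iff)
    with \<open>length p = n\<close> show "\<exists>w. (u, w) \<in> parcs G \<and> (\<exists>p. awalk w p v \<and> length p = n)" by blast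
  next
    assume "\<exists>w. (u, w) \<in> parcs G \<and> (\<exists>p. awalk w p v \<and> length p = n)"
    then obtain w p where "(u, w) \<in> parcs G" "awalk w p v" "length p = n" by blast
    then have "awalk u ((u, w) # p) v \<and> length ((u, w) # p) = Suc n"
      by (simp add: awalk_Cons_iff)
    then show "\<exists>p. awalk u p v \<and> length p = Suc n" by blast
  qed
  also have "\<dots> \<longleftrightarrow> (\<exists>w. (u, w) \<in> parcs G \<and> (w, v) \<in> parcs G ^^ n)"
    using Suc.IH in_arcsD2 by blast
  also have "\<dots> \<longleftrightarrow> (u, v) \<in> parcs G ^^ Suc n"
    by (meson relpow_Suc_D2 relpow_Suc_I2)
  finally show ?case .
qed

lemma graph_dist_eq_Least:
  "u \<in> pverts G \<Longrightarrow> graph_dist G u v = (LEAST n. (u, v) \<in> parcs G ^^ n)"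
  unfolding graph_dist_def by (simp add: awalk_length_iff_relpow)

lemma graph_dist_le: "u \<in> pverts G \<Longrightarrow> (u, v) \<in> parcs G ^^ n \<Longrightarrow> graph_dist G u v \<le> n"
  by (simp add: graph_dist_eq_Least Least_le)

lemma relpow_graph_dist:
  "u \<in> pverts G \<Longrightarrow> (u, v) \<in> parcs G ^^ n \<Longrightarrow> (u, v) \<in> parcs G ^^ graph_dist G u v"
  by (simp add: graph_dist_eq_Least) (rule LeastI)

lemma out_degree_eq: "out_degree G v = card {u. (v, u) \<in> parcs G}"
proof -
  have "out_arcs G v = Pair v ` {u. (v, u) \<in> parcs G}"
    by (auto simp: out_arcs_def)
  then show ?thesis by (simp add: out_degree_def card_image inj_on_def)
qed

end

lemma (in pair_sym_digraph) connected_iff_relpow: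
  "connected G \<longleftrightarrow> pverts G \<noteq> {} \<and> (\<forall>u\<in>pverts G. \<forall>v\<in>pverts G. \<exists>n. (u, v) \<in> parcs G ^^ n)"
proof -
  have "u \<rightarrow>\<^sup>*\<^bsub>mk_symmetric G\<^esub> v \<longleftrightarrow> (\<exists>n. (u, v) \<in> parcs G ^^ n)" if "u \<in> pverts G" for u v
    unfolding reachable_mk_symmetric_eq[OF sym_arcs] reachable_awalk
    using awalk_length_iff_relpow[OF that] by blast
  then show ?thesis by (simp add: connected_def strongly_connected_def mk_symmetric_def)
qed

lemma (in pair_fin_digraph) finite_dists:
  "finite {graph_dist G u v | u v. u \<in> verts G \<and> v \<in> verts G}"
proof -
  have "{graph_dist G u v | u v. u \<in> verts G \<and> v \<in> verts G}
      = (\<lambda>(u, v). graph_dist G u v) ` (pverts G \<times> pverts G)" by auto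
  then show ?thesis using pair_finite_verts by simp
qed

section \<open>The graph of a colored layering\<close>

definition layered_graph :: "'a set \<Rightarrow> ('a \<Rightarrow> nat) \<Rightarrow> ('a \<Rightarrow> nat) \<Rightarrow> 'a pair_pre_digraph" where
  "layered_graph V l c = \<lparr>pverts = V, parcs = {(u, v). u \<in> V \<and> v \<in> nbrs V l c u}\<rparr>"

lemma layered_graph_simps [simp]:
  "pverts (layered_graph V l c) = V"
  "(u, v) \<in> parcs (layered_graph V l c) \<longleftrightarrow> u \<in> V \<and> v \<in> nbrs V l c u"
  by (auto simp: layered_graph_def)

context colored_layering
begin

lemma sym_layered_graph: "sym (parcs (layered_graph V l c))"
  by (auto intro!: symI simp: nbrs_def)

lemma pair_graph_layered_graph: "pair_graph (layered_graph V l c)"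
proof unfold_locales
  show "finite (parcs (layered_graph V l c))"
    by (rule finite_subset[of _ "V \<times> V"]) (auto simp: nbrs_def fin)
  show "symmetric (layered_graph V l c)"
    using sym_layered_graph by (simp add: symmetric_def)
qed (auto simp: nbrs_def fin)

text \<open>An arc raises \<open>l\<close> by at most one. This bounds distances from
  \<open>x\<close> below; \<open>ancestor\<close> bounds them above.\<close>

lemma layer_le:
  assumes "(u, v) \<in> parcs (layered_graph V l c) ^^ n"
  shows "l v \<le> l u + n"
  using assms
proof (induction n arbitrary: v)
  case (Suc n)
  then obtain w where "(u, w) \<in> parcs (layered_graph V l c) ^^ n" "v \<in> nbrs V l c w" by auto
  with Suc.IH[of w] show ?case by (simp add: nbrs_def)
qed simp

lemma ancestor:
  assumes "v \<in> V" "m \<le> l v"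
  shows "\<exists>w\<in>V. l w = m \<and> (w, v) \<in> parcs (layered_graph V l c) ^^ (l v - m)"
  using assms(2)
proof (induction rule: inc_induct)
  case base
  then show ?case using assms by auto
next
  case (step m)
  then obtain w where w: "w \<in> V" "l w = Suc m" "(w, v) \<in> parcs (layered_graph V l c) ^^ (l v - Suc m)"
    by blast
  then obtain u where u: "u \<in> V" "l w = Suc (l u)" "c u \<noteq> c w" using parent[of w] by auto
  then have "(u, w) \<in> parcs (layered_graph V l c)" using w by (auto simp: nbrs_def)
  then have "(u, v) \<in> parcs (layered_graph V l c) ^^ Suc (l v - Suc m)"
    using w by (meson relpow_Suc_I2)
  moreover have "Suc (l v - Suc m) = l v - m" using step by simp
  ultimately show ?case using u w by (intro bexI[of _ u]) auto
qed

lemma graph_dist_layered_graph: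
  assumes v: "v \<in> V"
  shows "graph_dist (layered_graph V l c) x v = l v"
proof -
  interpret G: pair_graph "layered_graph V l c" by (rule pair_graph_layered_graph)
  obtain w where w: "w \<in> V" "l w = 0" "(w, v) \<in> parcs (layered_graph V l c) ^^ l v"
    using ancestor[OF v, of 0] by auto
  then have *: "(x, v) \<in> parcs (layered_graph V l c) ^^ l v" using root by auto
  have "l v \<le> l x + graph_dist (layered_graph V l c) x v"
    using x_in * by (intro layer_le G.relpow_graph_dist) auto
  moreover have "l x = 0" using root x_in by auto
  moreover have "graph_dist (layered_graph V l c) x v \<le> l v"
    using x_in * by (intro G.graph_dist_le) auto
  ultimately show ?thesis by simp
qed

lemma short_walk:
  assumes D: "2 \<le> D" and uv: "u \<in> V" "v \<in> V"
  shows "\<exists>n\<le>D. (u, v) \<in> parcs (layered_graph V l c) ^^ n"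
proof -
  let ?R = "parcs (layered_graph V l c)"
  have le: "\<exists>n\<le>D. (u, v) \<in> ?R ^^ n" if uv: "u \<in> V" "v \<in> V" "l u \<le> l v" for u v
  proof -
    consider "u = v" | "c u \<noteq> c v" "l u = l v" | "u \<noteq> v" "c u = c v" "l u = l v"
      | "l u < l v" "l u = 0" | "l u < l v" "l u > 0"
      using uv by fastforce
    then show ?thesis
    proof cases
      case 1
      then show ?thesis by (intro exI[of _ 0]) simp
    next
      case 2
      then have "(u, v) \<in> ?R ^^ 1" using uv by (auto simp: nbrs_def)
      then show ?thesis using D by (intro exI[of _ 1]) auto
    next
      case 3
      \<comment> \<open>Since \<open>u\<close> and \<open>v\<close> agree in layer and color, a
        parent of \<open>u\<close> is adjacent to both. This walk of length 2 requires
        \<open>2 \<le> D\<close>.\<close>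
      then have "l u > 0" using root uv by (metis gr0I)
      then obtain w where "w \<in> V" "l u = Suc (l w)" "c w \<noteq> c u" using parent uv by blast
      then have "(u, w) \<in> ?R" "(w, v) \<in> ?R" using uv 3 by (auto simp: nbrs_def)
      then have "(u, v) \<in> ?R ^^ 2" by (metis numeral_2_eq_2 relpow_0_I relpow_Suc_I2)
      then show ?thesis using D by (intro exI[of _ 2]) auto
    next
      case 4
      then obtain w where "w \<in> V" "l w = 0" "(w, v) \<in> ?R ^^ l v"
        using ancestor[OF uv(2), of 0] by auto
      moreover have "w = u" using root[of w] root[of u] 4 calculation uv by auto
      ultimately show ?thesis using le_D uv by blast
    next
      case 5
      then obtain w where w: "w \<in> V" "l w = Suc (l u)" "(w, v) \<in> ?R ^^ (l v - Suc (l u))"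
        using ancestor[OF uv(2), of "Suc (l u)"] by auto
      have lD: "l v \<le> D" using le_D uv by blast
      show ?thesis
      proof (cases "c u = c w")
        case False
        then have "(u, w) \<in> ?R" using w uv by (auto simp: nbrs_def)
        then have "(u, v) \<in> ?R ^^ Suc (l v - Suc (l u))" using w by (meson relpow_Suc_I2)
        then show ?thesis using lD 5 by (intro exI[of _ "Suc (l v - Suc (l u))"]) auto
      next
        case True
        \<comment> \<open>\<open>y\<close> lies in the layer of \<open>u\<close> but has another
          color, so going through \<open>y\<close> costs one extra arc; the total
          \<open>l v - l u + 1\<close> is at most \<open>D\<close> because
          \<open>l u > 0\<close>.\<close>
        obtain y where "y \<in> V" "l w = Suc (l y)" "c y \<noteq> c w" using parent[of w] w by auto
        then have "(u, y) \<in> ?R" "(y, w) \<in> ?R" using w uv True by (auto simp: nbrs_def)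
        then have "(u, v) \<in> ?R ^^ Suc (Suc (l v - Suc (l u)))" using w by (meson relpow_Suc_I2)
        then show ?thesis using lD 5 by (intro exI[of _ "Suc (Suc (l v - Suc (l u)))"]) auto
      qed
    qed
  qed
  show ?thesis
  proof (cases "l u \<le> l v")
    case True
    then show ?thesis using le uv by blast
  next
    case False
    then obtain n where "n \<le> D" "(v, u) \<in> ?R ^^ n" using le[of v u] uv by auto
    then show ?thesis using relpow_sym[OF sym_layered_graph] by blast
  qed
qed

lemma connected_layered_graph: "2 \<le> D \<Longrightarrow> connected (layered_graph V l c)"
proof -
  assume "2 \<le> D"
  interpret G: pair_graph "layered_graph V l c" by (rule pair_graph_layered_graph)
  show ?thesis using x_in short_walk[OF \<open>2 \<le> D\<close>] by (auto simp: G.connected_iff_relpow)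
qed

lemma eccentricity_layered_graph: "eccentricity (layered_graph V l c) x = D"
proof -
  have "graph_dist (layered_graph V l c) x ` V = l ` V"
    using graph_dist_layered_graph by simp
  moreover have "Max (l ` V) = D"
    using top fin le_D by (intro Max_eqI) auto
  ultimately show ?thesis by (simp add: eccentricity_def)
qed

lemma diameter_layered_graph:
  assumes "2 \<le> D"
  shows "diameter (layered_graph V l c) = D"
  unfolding diameter_def
proof (rule Max_eqI)
  interpret G: pair_graph "layered_graph V l c" by (rule pair_graph_layered_graph)
  show "finite {graph_dist (layered_graph V l c) u v |u v.
      u \<in> verts (layered_graph V l c) \<and> v \<in> verts (layered_graph V l c)}"
    by (rule G.finite_dists)
  show "d \<le> D" if "d \<in> {graph_dist (layered_graph V l c) u v |u v.
      u \<in> verts (layered_graph V l c) \<and> v \<in> verts (layered_graph V l c)}" for d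
    using that short_walk[OF assms] G.graph_dist_le by fastforce
  obtain v where "v \<in> V" "l v = D" using top by blast
  then show "D \<in> {graph_dist (layered_graph V l c) u v |u v.
      u \<in> verts (layered_graph V l c) \<and> v \<in> verts (layered_graph V l c)}"
    using graph_dist_layered_graph x_in by force
qed

lemma proper_coloring_layered_graph: "proper_coloring (layered_graph V l c) k c"
  using col_lt by (auto simp: proper_coloring_def nbrs_def)

lemma layer_layered_graph: "layer (layered_graph V l c) x j = {v \<in> V. l v = j}"
  using graph_dist_layered_graph by (auto simp: layer_def)

lemma min_degree_layered_graph:
  assumes "\<And>v. v \<in> V \<Longrightarrow> \<delta> \<le> card (nbrs V l c v)"
  shows "\<delta> \<le> min_degree (layered_graph V l c)"
proof -
  interpret G: pair_graph "layered_graph V l c" by (rule pair_graph_layered_graph)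
  have "out_degree (layered_graph V l c) v = card (nbrs V l c v)" if "v \<in> V" for v
    using that by (simp add: G.out_degree_eq)
  then show ?thesis
    unfolding min_degree_def using assms fin x_in by (intro Min.boundedI) auto
qed

text \<open>Degree sums are at most \<open>card V * card V\<close>, so a greatest one is
  attained.\<close>

lemma ex_max_layering:
  assumes "\<And>v. v \<in> V \<Longrightarrow> \<delta> \<le> card (nbrs V l c v)"
  shows "\<exists>l c. max_layering V x k D l c \<delta>"
proof -
  define ok where "ok = (\<lambda>(l, c). colored_layering V x k D l c \<and> (\<forall>v\<in>V. \<delta> \<le> card (nbrs V l c v)))"
  define f where "f = (\<lambda>(l, c). \<Sum>v\<in>V. card (nbrs V l c v))"
  have "f lc < Suc (card V * card V)" for lc
  proof -
    obtain l' c' where lc: "lc = (l', c')" by (cases lc)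
    have "card (nbrs V l' c' v) \<le> card V" for v
      using fin by (intro card_mono) (auto simp: nbrs_def)
    then have "f lc \<le> (\<Sum>v\<in>V. card V)"
      unfolding f_def lc prod.case by (intro sum_mono)
    then show ?thesis by simp
  qed
  moreover have "ok (l, c)" using assms colored_layering_axioms by (simp add: ok_def)
  ultimately obtain lc where "ok lc" "\<And>lc'. ok lc' \<Longrightarrow> f lc' \<le> f lc"
    using ex_has_greatest_nat[of ok "(l, c)" f "Suc (card V * card V)"] by blast
  moreover obtain l' c' where "lc = (l', c')" by (cases lc)
  ultimately have "max_layering V x k D l' c' \<delta>"
    by (auto simp: ok_def f_def max_layering_def max_layering_axioms_def)
  then show ?thesis by blast
qed

end

section \<open>From the given graph to a layering, and the conclusion\<close>

lemma (in pair_graph) distance_layering: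
  assumes conn: "connected G" and col: "proper_coloring G k col"
    and xy: "x \<in> pverts G" "y \<in> pverts G" "graph_dist G x y = diameter G"
  shows "colored_layering (pverts G) x k (diameter G) (graph_dist G x) col"
    and "v \<in> pverts G \<Longrightarrow> out_degree G v \<le> card (nbrs (pverts G) (graph_dist G x) col v)"
proof -
  have walk: "(u, v) \<in> parcs G ^^ graph_dist G u v" if "u \<in> pverts G" "v \<in> pverts G" for u v
    using conn that relpow_graph_dist by (meson connected_iff_relpow)
  have col_arc: "col u \<noteq> col v" if "(u, v) \<in> parcs G" for u v
    using col that by (auto simp: proper_coloring_def)
  have step: "graph_dist G x v \<le> Suc (graph_dist G x u)" if "(u, v) \<in> parcs G" for u v
    using that in_arcsD1[OF that] xy walk by (intro graph_dist_le) auto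
  show "colored_layering (pverts G) x k (diameter G) (graph_dist G x) col"
  proof unfold_locales
    show "graph_dist G x v = 0 \<longleftrightarrow> v = x" if "v \<in> pverts G" for v
      using walk[OF xy(1) that] graph_dist_le[OF xy(1), of v 0] by auto
    show "graph_dist G x v \<le> diameter G" if "v \<in> pverts G" for v
      unfolding diameter_def using finite_dists xy that by (intro Max_ge) auto
    show "\<exists>v\<in>pverts G. graph_dist G x v = diameter G" using xy by blast
    show "col v < k" if "v \<in> pverts G" for v
      using col that by (auto simp: proper_coloring_def)
    show "\<exists>u\<in>pverts G. graph_dist G x v = Suc (graph_dist G x u) \<and> col u \<noteq> col v"
      if v: "v \<in> pverts G" "0 < graph_dist G x v" for v
    proof -
      \<comment> \<open>The parent is the last vertex before \<open>v\<close> on a shortest walk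
        from \<open>x\<close>.\<close>
      obtain n where n: "graph_dist G x v = Suc n" using v gr0_implies_Suc by blast
      with walk[OF xy(1) v(1)] obtain u where u: "(x, u) \<in> parcs G ^^ n" "(u, v) \<in> parcs G"
        by auto
      have "graph_dist G x u \<le> n" using xy u by (intro graph_dist_le)
      with step[OF u(2)] n have "graph_dist G x v = Suc (graph_dist G x u)" by simp
      then show ?thesis using u col_arc in_arcsD1 by blast
    qed
  qed (use xy pair_finite_verts in auto)
  show "out_degree G v \<le> card (nbrs (pverts G) (graph_dist G x) col v)" if "v \<in> pverts G"
    unfolding out_degree_eq
  proof (rule card_mono)
    show "finite (nbrs (pverts G) (graph_dist G x) col v)"
      using pair_finite_verts by (simp add: nbrs_def)
    \<comment> \<open>Arcs join differently colored vertices in equal or consecutive layers, so the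
      layering only adds edges.\<close>
    show "{u. (v, u) \<in> parcs G} \<subseteq> nbrs (pverts G) (graph_dist G x) col v"
      using in_arcsD2 step arcs_symmetric by (fastforce simp: nbrs_def dest: col_arc)
  qed
qed

theorem theorem4p1:
  fixes G' :: "'a pair_pre_digraph" and k n D \<delta> :: nat
  assumes "k \<ge> 3"
    and "pair_graph G'" and "connected G'" and "colorable G' k"
    and "card (verts G') = n" and "diameter G' = D" and "min_degree G' \<ge> \<delta>"
  shows "\<exists>(G :: 'a pair_pre_digraph) col x.
    pair_graph G \<and> connected G \<and>
    card (verts G) = n \<and> diameter G = D \<and> min_degree G \<ge> \<delta> \<and>
    proper_coloring G k col \<and> x \<in> verts G \<and> eccentricity G x = D \<and>
    (let L = layer G x; c = (\<lambda>j. num_colors col (L j)) in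
      \<forall>i<D.
        (c i = 1 \<longrightarrow> c (i + 1) \<le> k - 1) \<and>
        (num_colors col (L i \<union> L (i + 1)) = min k (c i + c (i + 1)) \<and>
         (c i + c (i + 1) \<le> k \<longrightarrow> col ` L i \<inter> col ` L (i + 1) = {})) \<and>
        (c i = k \<longrightarrow> i \<ge> 2 \<and> c (i + 1) \<ge> 2) \<and>
        (card (L i) > c i \<longrightarrow> i > 0 \<and> c i + max (c (i - 1)) (c (i + 1)) \<ge> k))"
proof -
  interpret G': pair_graph G' by fact
  obtain col where col: "proper_coloring G' k col"
    using assms(4) by (auto simp: colorable_def)
  have ne: "pverts G' \<noteq> {}" using assms(3) by (simp add: G'.connected_iff_relpow)
  have "diameter G' \<in> {graph_dist G' u v | u v. u \<in> verts G' \<and> v \<in> verts G'}"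
    unfolding diameter_def using ne by (intro Max_in G'.finite_dists) auto
  then obtain x y where xy: "x \<in> pverts G'" "y \<in> pverts G'" "graph_dist G' x y = diameter G'"
    by auto
  interpret layers: colored_layering "pverts G'" x k D "graph_dist G' x" col
    using G'.distance_layering(1)[OF assms(3) col xy] assms(6) by simp
  have deg: "\<delta> \<le> card (nbrs (pverts G') (graph_dist G' x) col v)" if v: "v \<in> pverts G'" for v
  proof -
    have "\<delta> \<le> out_degree G' v"
      using assms(7) v G'.pair_finite_verts by (auto simp: min_degree_def intro: order_trans)
    then show ?thesis using G'.distance_layering(2)[OF assms(3) col xy v] by simp
  qed
  show ?thesis
  proof (cases "2 \<le> D")
    case True
    obtain l c where "max_layering (pverts G') x k D l c \<delta>"
      using layers.ex_max_layering[OF deg] by blast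
    then interpret M: max_layering "pverts G'" x k D l c \<delta> .
    show ?thesis
      using True M.deg assms(5) M.x_in M.canonical[OF assms(1)]
      by (intro exI[of _ "layered_graph (pverts G') l c"] exI[of _ c] exI[of _ x])
        (simp add: M.pair_graph_layered_graph M.connected_layered_graph M.diameter_layered_graph
          M.min_degree_layered_graph M.proper_coloring_layered_graph M.eccentricity_layered_graph
          M.layer_layered_graph num_colors_def Let_def)
  next
    \<comment> \<open>\<open>short_walk\<close> does not cover \<open>D \<le> 1\<close>, so
      \<open>G'\<close> itself is the witness. At most \<open>i = 0\<close> has to be checked, where
      layer 0 is \<open>{x}\<close> and no vertex of layer 1 has the color of
      \<open>x\<close>.\<close>
    case False
    have L0: "layer G' x 0 = {x}" using layers.root xy by (auto simp: layer_def)
    have new: "col x \<notin> col ` layer G' x 1"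
      using layers.parent layers.root by (fastforce simp: layer_def)
    have fin: "finite (layer G' x 1)" using G'.pair_finite_verts by (simp add: layer_def)
    have "col ` layer G' x 1 \<subseteq> {..<k}" using layers.col_lt by (auto simp: layer_def)
    with new have "col ` layer G' x 1 \<subseteq> {..<k} - {col x}" by blast
    then have "card (col ` layer G' x 1) \<le> card ({..<k} - {col x})" by (intro card_mono) auto
    then have le: "card (col ` layer G' x 1) \<le> k - 1" using layers.col_lt xy by simp
    have ecc: "eccentricity G' x = D"
      unfolding eccentricity_def using layers.top layers.le_D layers.fin by (intro Max_eqI) auto
    have less_D: "(\<forall>i<D. Q i) \<longleftrightarrow> (D = 1 \<longrightarrow> Q 0)" for Q
    proof -
      have "D = 0 \<or> D = 1" using False by linarith
      then show ?thesis by auto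
    qed
    show ?thesis
      using assms ecc xy L0 new le fin col
      by (intro exI[of _ G'] exI[of _ col] exI[of _ x])
        (simp add: less_D Let_def num_colors_def card_insert_if)
  qed
qed


end
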